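(* For all integers $n\geq 0$ and $k\geq 0$, \[ b\left(3^{2(k+1)}n+\frac{5\cdot 3^{2(k+1)}+3}{8}\right)\equiv (-1)^k\, b(9n+6)\pmod{3}, \] and for all integers $n\geq 0$, \[ b(81n+24)\equiv -\,b(9n+3)\pmod{3}. \]
   Context: For $m\in\mathbb{N}$ and $|q|<1$ let $f_m:=\prod_{n\geq 1}(1-q^{mn})$. Let $b(n)$ denote the number of partition triples $(\pi_1,\pi_2,\pi_3)$ of $n$ (i.e. $\pi_1,\pi_2,\pi_3$ are partitions whose sizes sum to $n$) such that $\pi_1$ consists of distinct odd parts and $\pi_2$ and $\pi_3$ consist of parts divisible by $4$, with $b(0)=1$. Equivalently, $\sum_{n\geq 0} b(n)q^n = \dfrac{f_2^2}{f_1f_4^3}$. *)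

theory Defs
  imports Main "HOL-Library.Multiset" "HOL-Number_Theory.Cong"
begin

definition is_partition :: "nat multiset \<Rightarrow> bool" where
  "is_partition p \<longleftrightarrow> (\<forall>x\<in>#p. 0 < x)"

definition psize :: "nat multiset \<Rightarrow> nat" where
  "psize p = sum_mset p"

definition b :: "nat \<Rightarrow> nat" where
  "b n = card {(p1, p2, p3). is_partition p1 \<and> is_partition p2 \<and> is_partition p3
      \<and> psize p1 + psize p2 + psize p3 = n
      \<and> (\<forall>x. count p1 x \<le> 1) \<and> (\<forall>x\<in>#p1. odd x)
      \<and> (\<forall>x\<in>#p2. 4 dvd x) \<and> (\<forall>x\<in>#p3. 4 dvd x)}"

end

theory Submission
  imports Defs "HOL-Computational_Algebra.Formal_Power_Series" "Berlekamp_Zassenhaus.Finite_Field"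
begin

text \<open>
  All computations take place in \<open>GF(3)[[q]]\<close>, where \<open>g(q\<^sup>3) = g(q)\<^sup>3\<close>. With
  \<open>x = f\<^sub>1\<close>, \<open>y = f\<^sub>2\<close>, \<open>z = f\<^sub>4\<close> every series that occurs is a rational function of \<open>x, y, z\<close>:
  the generating function of \<open>b\<close> is \<open>y\<^sup>2 / (x z\<^sup>3)\<close>, and taking the terms with index
  \<open>r\<close> modulo 3 commutes with multiplication by cubes.

  The only input from theta functions is \<open>x\<^sup>8 y\<^sup>8 = x\<^sup>2\<^sup>4 + q y\<^sup>2\<^sup>4\<close> together with its image
  under \<open>q \<mapsto> q\<^sup>2\<close>. It is the 3-dissection of \<open>\<phi>(-q) = \<Sum> (-1)\<^sup>n q\<^bsup>n\<^sup>2\<^esup>\<close>, both parts of which are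
  products by the Jacobi triple product. The two instances imply the dissection
  \<open>y\<^sup>8 (xz)\<^sup>1\<^sup>6 = y\<^sup>4\<^sup>8 - q (xz)\<^sup>2\<^sup>4\<close> of \<open>\<psi>(-q) = xz / y\<close>. Dissecting repeatedly gives
  \<open>\<Sum> b(9n+6) q\<^sup>n = x\<^sup>7 z\<^sup>5 / y\<^sup>6\<close> and \<open>\<Sum> b(9n+3) q\<^sup>n = y\<^sup>1\<^sup>0 / (x z\<^sup>3)\<close>, and two more dissections of the
  former return the negatives of both series.
\<close>

unbundle fps_syntax

section \<open>Infinite products\<close>

text \<open>Coefficient \<open>n\<close> of a product involves only the coefficients up to
  \<open>n\<close> of the factors, and each of these is eventually constant.\<close>

lemma tendsto_mult_fps:
  fixes f g :: "'b \<Rightarrow> 'a :: ring_1 fps"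
  assumes "(f \<longlongrightarrow> a) F" "(g \<longlongrightarrow> c) F"
  shows "((\<lambda>x. f x * g x) \<longlongrightarrow> a * c) F"
proof (rule tendsto_fpsI)
  fix n
  have "\<forall>\<^sub>F x in F. \<forall>i\<in>{..n}. f x $ i = a $ i"
    using assms(1) by (simp add: tendsto_fps_iff eventually_ball_finite_distrib)
  moreover have "\<forall>\<^sub>F x in F. \<forall>i\<in>{..n}. g x $ i = c $ i"
    using assms(2) by (simp add: tendsto_fps_iff eventually_ball_finite_distrib)
  ultimately show "\<forall>\<^sub>F x in F. (f x * g x) $ n = (a * c) $ n"
    by eventually_elim (auto simp: fps_mult_nth intro!: sum.cong)
qed

lemma tendsto_power_fps:
  fixes f :: "'b \<Rightarrow> 'a :: ring_1 fps"
  assumes "(f \<longlongrightarrow> a) F"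
  shows "((\<lambda>x. f x ^ n) \<longlongrightarrow> a ^ n) F"
proof (induction n)
  case (Suc n)
  show ?case
    unfolding power_Suc by (rule tendsto_mult_fps[OF assms Suc])
qed simp

text \<open>The finite q-Pochhammer symbol (q^a; q^d)_N with q = \<open>fps_X\<close>.\<close>

definition qpoch :: "nat \<Rightarrow> nat \<Rightarrow> nat \<Rightarrow> 'a :: field fps" where
  "qpoch a d N = (\<Prod>i<N. 1 - fps_X ^ (a + d * i))"

text \<open>The infinite product (q^a; q^d); thus \<open>qprod m m\<close> is f_m. For
  \<open>d > 0\<close> the factors of index greater than \<open>n\<close> do not affect coefficient
  \<open>n\<close>, so \<open>Suc n\<close> factors suffice.\<close>

definition qprod :: "nat \<Rightarrow> nat \<Rightarrow> 'a :: field fps" where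
  "qprod a d = Abs_fps (\<lambda>n. qpoch a d (Suc n) $ n)"

lemma qpoch_0 [simp]: "qpoch a d 0 = 1"
  and qpoch_Suc: "qpoch a d (Suc N) = qpoch a d N * (1 - fps_X ^ (a + d * N))"
  by (simp_all add: qpoch_def)

lemma qpoch_nth_stable:
  assumes "d > 0" "Suc n \<le> N"
  shows "qpoch a d N $ n = qpoch a d (Suc n) $ n"
  using assms(2)
proof (induction N rule: dec_induct)
  case (step M)
  have "M \<le> d * M"
    using assms(1) by simp
  with step have "n < a + d * M"
    by linarith
  thus ?case
    using step by (simp add: qpoch_Suc[of a d M] right_diff_distrib fps_X_power_mult_right_nth)
qed (use assms in auto)

lemma qpoch_tendsto:
  assumes "d > 0"
  shows "qpoch a d \<longlonglongrightarrow> qprod a d"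
proof (rule tendsto_fpsI)
  fix n
  show "\<forall>\<^sub>F N in sequentially. qpoch a d N $ n = qprod a d $ n"
    using eventually_gt_at_top[of n]
  proof eventually_elim
    case (elim N)
    thus ?case
      using qpoch_nth_stable[OF assms, of n N a] by (simp add: qprod_def)
  qed
qed

lemma qpoch_tendsto_compose:
  assumes "d > 0" "filterlim g sequentially sequentially"
  shows "(\<lambda>N. qpoch a d (g N)) \<longlonglongrightarrow> qprod a d"
  using qpoch_tendsto[OF assms(1)] assms(2) by (rule filterlim_compose)

lemma qpoch_nth_0: "a > 0 \<Longrightarrow> qpoch a d N $ 0 = 1"
  by (induction N) (simp_all add: qpoch_Suc)

lemma qprod_nth_0: "a > 0 \<Longrightarrow> qprod a d $ 0 = 1"
  by (simp add: qprod_def qpoch_nth_0)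

lemma qprod_nonzero:
  assumes "a > 0"
  shows "qprod a d \<noteq> (0 :: 'a :: field fps)"
proof
  assume "qprod a d = (0 :: 'a fps)"
  with qprod_nth_0[OF assms, of d, where 'a = 'a] show False by simp
qed

text \<open>Group the factors by the parity of their index. For \<open>a = d = m\<close> this reads
  f_m = (q^m; q^(2m)) f_(2m).\<close>

lemma qprod_split2:
  assumes "d > 0"
  shows "qprod a d = qprod a (2 * d) * (qprod (a + d) (2 * d) :: 'a :: field fps)"
proof (rule LIMSEQ_unique)
  have "qpoch a d (2 * N) = qpoch a (2 * d) N * (qpoch (a + d) (2 * d) N :: 'a fps)" for N
  proof (induction N)
    case (Suc N)
    have "2 * Suc N = Suc (Suc (2 * N))" by simp
    moreover have "a + d * (2 * N) = a + 2 * d * N" "a + d * Suc (2 * N) = a + d + 2 * d * N"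
      by (simp_all add: algebra_simps)
    ultimately show ?case using Suc by (simp only: qpoch_Suc mult_ac)
  qed simp
  moreover have "(\<lambda>N. qpoch a d (2 * N)) \<longlonglongrightarrow> (qprod a d :: 'a fps)"
    using assms by (intro qpoch_tendsto_compose) (auto intro: mult_nat_left_at_top)
  ultimately show "(\<lambda>N. qpoch a (2 * d) N * qpoch (a + d) (2 * d) N) \<longlonglongrightarrow> (qprod a d :: 'a fps)"
    by simp
next
  show "(\<lambda>N. qpoch a (2 * d) N * qpoch (a + d) (2 * d) N) \<longlonglongrightarrow> qprod a (2 * d) * (qprod (a + d) (2 * d) :: 'a fps)"
    using assms by (intro tendsto_mult_fps qpoch_tendsto) simp_all
qed

lemma qprod_split3:
  assumes "d > 0"
  shows "qprod a d = qprod a (3 * d) * qprod (a + d) (3 * d) * (qprod (a + 2 * d) (3 * d) :: 'a :: field fps)"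
proof (rule LIMSEQ_unique)
  have "qpoch a d (3 * N) = qpoch a (3 * d) N * qpoch (a + d) (3 * d) N * (qpoch (a + 2 * d) (3 * d) N :: 'a fps)" for N
  proof (induction N)
    case (Suc N)
    have "3 * Suc N = Suc (Suc (Suc (3 * N)))" by simp
    moreover have "a + d * (3 * N) = a + 3 * d * N" "a + d * Suc (3 * N) = a + d + 3 * d * N"
      "a + d * Suc (Suc (3 * N)) = a + 2 * d + 3 * d * N"
      by (simp_all add: algebra_simps)
    ultimately show ?case using Suc by (simp only: qpoch_Suc mult_ac)
  qed simp
  moreover have "(\<lambda>N. qpoch a d (3 * N)) \<longlonglongrightarrow> (qprod a d :: 'a fps)"
    using assms by (intro qpoch_tendsto_compose) (auto intro: mult_nat_left_at_top)
  ultimately show "(\<lambda>N. qpoch a (3 * d) N * qpoch (a + d) (3 * d) N * qpoch (a + 2 * d) (3 * d) N)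
      \<longlonglongrightarrow> (qprod a d :: 'a fps)"
    by simp
next
  show "(\<lambda>N. qpoch a (3 * d) N * qpoch (a + d) (3 * d) N * qpoch (a + 2 * d) (3 * d) N)
      \<longlonglongrightarrow> qprod a (3 * d) * qprod (a + d) (3 * d) * (qprod (a + 2 * d) (3 * d) :: 'a fps)"
    using assms by (intro tendsto_mult_fps qpoch_tendsto) simp_all
qed

section \<open>The Jacobi triple product\<close>

text \<open>Gaussian binomial coefficients, given by a Pascal rule so that no division is
  involved.\<close>

fun qbin :: "'a :: comm_ring_1 \<Rightarrow> nat \<Rightarrow> nat \<Rightarrow> 'a" where
  "qbin q n 0 = 1"
| "qbin q 0 (Suc j) = 0"
| "qbin q (Suc n) (Suc j) = qbin q n j + q ^ Suc j * qbin q n (Suc j)"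

lemma qbin_eq_0: "n < j \<Longrightarrow> qbin q n j = 0"
  by (induction q n j rule: qbin.induct) auto

text \<open>The mirror image of the defining Pascal rule. The finite triple product can grow at two
  ends and needs one rule for each.\<close>

lemma qbin_Suc_Suc':
  "j \<le> n \<Longrightarrow> qbin q (Suc n) (Suc j) = qbin q n (Suc j) + q ^ (n - j) * qbin q n j"
proof (induction n arbitrary: j)
  case (Suc n)
  have IH: "qbin q (Suc n) (Suc i) = qbin q n (Suc i) + q ^ (n - i) * qbin q n i" if "i \<le> n" for i
    using Suc.IH that .
  show ?case
  proof (cases "j = Suc n")
    case True
    thus ?thesis by (simp add: qbin_eq_0)
  next
    case False
    hence j: "j \<le> n" using Suc.prems by simp
    show ?thesis
    proof (cases j)
      case 0
      thus ?thesis using IH[of 0] by (simp add: algebra_simps del: qbin.simps(3)) (simp add: algebra_simps)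
    next
      case (Suc i)
      have e: "q ^ Suc j * q ^ (n - j) = q ^ (n - i) * q ^ Suc i"
        using j Suc by (simp flip: power_add power_Suc)
      have "qbin q (Suc (Suc n)) (Suc j) = qbin q (Suc n) j + q ^ Suc j * qbin q (Suc n) (Suc j)"
        by simp
      also have "qbin q (Suc n) j = qbin q n j + q ^ (n - i) * qbin q n i"
        using IH[of i] j Suc by simp
      also have "qbin q (Suc n) (Suc j) = qbin q n (Suc j) + q ^ (n - j) * qbin q n j"
        using IH[of j] j by simp
      finally have "qbin q (Suc (Suc n)) (Suc j) = qbin q n j + q ^ (n - i) * qbin q n i
          + (q ^ Suc j * qbin q n (Suc j) + (q ^ Suc j * q ^ (n - j)) * qbin q n j)"
        by (simp only: algebra_simps)
      also have "\<dots> = qbin q (Suc n) (Suc j) + q ^ (n - i) * qbin q (Suc n) (Suc i)"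
        unfolding e using Suc by (simp add: algebra_simps)
      finally show ?thesis using Suc by simp
    qed
  qed
qed auto

text \<open>The quotient formula for Gaussian binomials with denominators cleared. Pascal's rule
  reduces it to (1 - Q^a) + Q^a (1 - Q^c) = 1 - Q^(a+c) for Q = q^d.\<close>

lemma qbin_mult_qpoch:
  "qbin (fps_X ^ d) (a + c) a * qpoch d d a * qpoch d d c = (qpoch d d (a + c) :: 'a :: field fps)"
proof (induction "a + c" arbitrary: a c)
  case (Suc n)
  let ?q = "fps_X ^ d :: 'a fps"
  have S: "qpoch d d (Suc k) = qpoch d d k * (1 - ?q ^ Suc k)" for k
    by (simp add: qpoch_Suc power_mult[symmetric] algebra_simps flip: power_add)
  show ?case
  proof (cases "a = 0 \<or> c = 0")
    case True
    have "qbin ?q k k = 1" for k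
      by (induction k) (auto simp: qbin_eq_0)
    with True show ?thesis by auto
  next
    case False
    then obtain a' c' where ac: "a = Suc a'" "c = Suc c'"
      by (auto simp: gr0_conv_Suc)
    with Suc(2) have n: "n = a' + c" "n = a + c'" by auto
    have 1: "qbin ?q n a' * qpoch d d a' * qpoch d d c = qpoch d d n"
      using Suc(1)[of a' c] n by simp
    have 2: "qbin ?q n a * qpoch d d a * qpoch d d c' = qpoch d d n"
      using Suc(1)[of a c'] n by simp
    have "qbin ?q (a + c) a = qbin ?q n a' + ?q ^ a * qbin ?q n a"
      using Suc(2) ac by (metis qbin.simps(3))
    hence "qbin ?q (a + c) a * qpoch d d a * qpoch d d c =
      (qbin ?q n a' * qpoch d d a' * qpoch d d c) * (1 - ?q ^ a) +
      ?q ^ a * (1 - ?q ^ c) * (qbin ?q n a * qpoch d d a * qpoch d d c')"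
      unfolding ac S by (simp only: algebra_simps)
    also have "\<dots> = qpoch d d n * (1 - ?q ^ (a + c))"
      unfolding 1 2 by (simp add: algebra_simps power_add)
    also have "\<dots> = qpoch d d (a + c)"
      using S[of n] Suc(2) by simp
    finally show ?thesis .
  qed
qed auto

text \<open>Triangular numbers at integer arguments; k(k+1) is never negative, so \<open>nat\<close>
  loses nothing.\<close>

definition tri :: "int \<Rightarrow> nat" where
  "tri k = nat (k * (k + 1) div 2)"

text \<open>\<open>theta r s\<close> is Ramanujan's \<open>f(-q\<^sup>r, -q\<^sup>s)\<close>.\<close>

definition theta_exp :: "nat \<Rightarrow> nat \<Rightarrow> int \<Rightarrow> nat" where
  "theta_exp r s k = r * tri k + s * tri (k - 1)"

definition theta_term :: "nat \<Rightarrow> nat \<Rightarrow> int \<Rightarrow> 'a :: field fps" where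
  "theta_term r s k = (if even k then 1 else -1) * fps_X ^ theta_exp r s k"

definition theta :: "nat \<Rightarrow> nat \<Rightarrow> 'a :: field fps" where
  "theta r s = Abs_fps (\<lambda>n. \<Sum>k | theta_exp r s k = n. if even k then 1 else -1)"

lemma int_tri: "int (tri k) = k * (k + 1) div 2"
proof -
  have "k * (k + 1) \<ge> 0"
    by (cases "k \<ge> 0") (auto intro: mult_nonneg_nonneg mult_nonpos_nonpos)
  thus ?thesis by (simp add: tri_def)
qed

lemma two_int_tri: "2 * int (tri k) = k * (k + 1)"
  unfolding int_tri by (simp add: even_two_times_div_two)

lemma tri_diff: "int (tri k) = int (tri (k - 1)) + k"
  using two_int_tri[of k] two_int_tri[of "k - 1"] by (simp add: algebra_simps)

lemma tri_sum: "int (tri k + tri (k - 1)) = k\<^sup>2"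
  using two_int_tri[of k] two_int_tri[of "k - 1"] by (simp add: algebra_simps power2_eq_square)

text \<open>The exponent is at least \<open>tri k + tri (k - 1)\<close>, which is k^2. Hence each
  power of q arises from finitely many \<open>k\<close> only.\<close>

lemma abs_le_theta_exp:
  assumes "r > 0" "s > 0"
  shows "\<bar>k\<bar> \<le> int (theta_exp r s k)"
proof -
  have "\<bar>k\<bar> \<le> k\<^sup>2"
    using self_le_power[of "\<bar>k\<bar>" 2] by (cases "k = 0") auto
  also have "\<dots> = int (tri k + tri (k - 1))"
    by (simp only: tri_sum)
  also have "tri k + tri (k - 1) \<le> theta_exp r s k"
    using assms unfolding theta_exp_def by (intro add_mono) auto
  finally show ?thesis by simp
qed

lemma finite_theta_exp:
  assumes "r > 0" "s > 0"
  shows "finite {k. theta_exp r s k \<le> n}"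
proof (rule finite_subset)
  show "{k. theta_exp r s k \<le> n} \<subseteq> {- int n..int n}"
  proof
    fix k assume "k \<in> {k. theta_exp r s k \<le> n}"
    thus "k \<in> {- int n..int n}"
      using abs_le_theta_exp[OF assms, of k] by (auto simp: abs_le_iff)
  qed
qed simp

text \<open>Passing from \<open>k - 1\<close> to \<open>k\<close> flips the sign, and the exponents
  agree by the recurrence of the triangular numbers. This absorbs the power of q in the next factor
  of \<open>qpoch r (r + s)\<close>; the hypothesis keeps \<open>nat\<close> from
  truncating.\<close>

lemma theta_term_up:
  assumes "k \<le> int M + 1"
  shows "theta_term r s (k - 1) * fps_X ^ (r + (r + s) * M) =
    - (theta_term r s k * (fps_X ^ (r + s)) ^ nat (int M + 1 - k))"
proof -
  have "int (theta_exp r s (k - 1) + (r + (r + s) * M)) =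
      int (theta_exp r s k + (r + s) * nat (int M + 1 - k))"
  proof -
    have "int (tri (k - 1)) = int (tri (k - 2)) + (k - 1)"
      using tri_diff[of "k - 1"] by simp
    thus ?thesis
      using assms by (simp add: theta_exp_def tri_diff[of k]) (simp add: algebra_simps)
  qed
  hence "theta_exp r s (k - 1) + (r + (r + s) * M) = theta_exp r s k + (r + s) * nat (int M + 1 - k)"
    by (simp only: of_nat_eq_iff)
  thus ?thesis
    by (simp add: theta_term_def flip: power_mult power_add)
qed

lemma theta_term_down:
  assumes "- int N - 1 \<le> k"
  shows "theta_term r s (k + 1) * fps_X ^ (s + (r + s) * N) =
    - (theta_term r s k * (fps_X ^ (r + s)) ^ nat (int N + 1 + k))"
proof -
  have "int (theta_exp r s (k + 1) + (s + (r + s) * N)) =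
      int (theta_exp r s k + (r + s) * nat (int N + 1 + k))"
  proof -
    have "int (tri (k + 1)) = int (tri k) + (k + 1)"
      using tri_diff[of "k + 1"] by simp
    thus ?thesis
      using assms by (simp add: theta_exp_def tri_diff[of k]) (simp add: algebra_simps)
  qed
  hence "theta_exp r s (k + 1) + (s + (r + s) * N) = theta_exp r s k + (r + s) * nat (int N + 1 + k)"
    by (simp only: of_nat_eq_iff)
  thus ?thesis
    by (simp add: theta_term_def flip: power_mult power_add)
qed

text \<open>The finite form of the Jacobi triple product. Each induction step adds one factor 1 -
  q^e: a Pascal rule splits the new sum into the old one and a second one, which the shift lemmas
  turn into -q^e times the old one.\<close>

lemma finite_triple_product:
  "qpoch r (r + s) M * qpoch s (r + s) N =
    (\<Sum>j\<le>M + N. qbin (fps_X ^ (r + s)) (M + N) j * (theta_term r s (int j - int N) :: 'a :: field fps))"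
proof (induction M)
  case 0
  show ?case
  proof (induction N)
    case 0
    show ?case by (simp add: theta_term_def theta_exp_def tri_def)
  next
    case (Suc N)
    let ?q = "fps_X ^ (r + s) :: 'a fps" and ?w = "theta_term r s :: int \<Rightarrow> 'a fps"
    have "(\<Sum>j\<le>Suc N. qbin ?q (Suc N) j * ?w (int j - int (Suc N))) =
        ?w (- int (Suc N)) + (\<Sum>j\<le>N. qbin ?q (Suc N) (Suc j) * ?w (int j - int N))"
      by (subst sum.atMost_Suc_shift) simp
    also have "\<dots> = (\<Sum>j\<le>N. qbin ?q N j * ?w (int j - int N)) + (?w (- int (Suc N))
        + (\<Sum>j\<le>N. qbin ?q N (Suc j) * (?q ^ Suc j * ?w (int (Suc j) - int (Suc N)))))"
      by (simp add: algebra_simps sum.distrib)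
    \<comment> \<open>The detached first term is the missing \<open>j = 0\<close> term of the second
      sum; the top term of the completed sum then vanishes.\<close>
    also have "?w (- int (Suc N)) + (\<Sum>j\<le>N. qbin ?q N (Suc j) * (?q ^ Suc j * ?w (int (Suc j) - int (Suc N))))
        = (\<Sum>j\<le>Suc N. qbin ?q N j * (?q ^ j * ?w (int j - int (Suc N))))"
      using sum.atMost_Suc_shift[of "\<lambda>j. qbin ?q N j * (?q ^ j * ?w (int j - int (Suc N)))" N] by simp
    also have "\<dots> = (\<Sum>j\<le>N. qbin ?q N j * (?q ^ j * ?w (int j - int (Suc N))))"
      by (simp add: qbin_eq_0)
    also have "\<dots> = (\<Sum>j\<le>N. - (fps_X ^ (s + (r + s) * N) * (qbin ?q N j * ?w (int j - int N))))"
    proof (rule sum.cong)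
      fix j assume "j \<in> {..N}"
      have "?w (int j - int N) * fps_X ^ (s + (r + s) * N) = - (?w (int j - int (Suc N)) * ?q ^ j)"
        using theta_term_down[of N "int j - int (Suc N)" r s, where 'a = 'a] by simp
      hence "?q ^ j * ?w (int j - int (Suc N)) = - (fps_X ^ (s + (r + s) * N) * ?w (int j - int N))"
        by (simp add: mult.commute)
      thus "qbin ?q N j * (?q ^ j * ?w (int j - int (Suc N))) =
          - (fps_X ^ (s + (r + s) * N) * (qbin ?q N j * ?w (int j - int N)))"
        by (simp only: mult_minus_right mult.left_commute)
    qed simp
    also have "(\<Sum>j\<le>N. qbin ?q N j * ?w (int j - int N)) + \<dots> =
        (\<Sum>j\<le>N. qbin ?q N j * ?w (int j - int N)) * (1 - fps_X ^ (s + (r + s) * N))"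
      by (simp add: right_diff_distrib left_diff_distrib sum_negf mult.commute flip: sum_distrib_left)
    finally show ?case
      using Suc by (simp add: qpoch_Suc)
  qed
next
  case (Suc M)
  let ?q = "fps_X ^ (r + s) :: 'a fps" and ?w = "theta_term r s :: int \<Rightarrow> 'a fps"
  define n where "n = M + N"
  have "(\<Sum>j\<le>Suc n. qbin ?q (Suc n) j * ?w (int j - int N)) =
      ?w (- int N) + (\<Sum>j\<le>n. qbin ?q (Suc n) (Suc j) * ?w (int (Suc j) - int N))"
    by (subst sum.atMost_Suc_shift) simp
  \<comment> \<open>A new factor counted by \<open>M\<close> keeps the offset \<open>N\<close> and
    extends the sum at the top, which calls for the mirrored Pascal rule.\<close>
  also have "(\<Sum>j\<le>n. qbin ?q (Suc n) (Suc j) * ?w (int (Suc j) - int N)) =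
      (\<Sum>j\<le>n. qbin ?q n (Suc j) * ?w (int (Suc j) - int N)) +
      (\<Sum>j\<le>n. qbin ?q n j * (?q ^ (n - j) * ?w (int (Suc j) - int N)))"
    unfolding sum.distrib[symmetric]
    by (intro sum.cong refl, subst qbin_Suc_Suc') (auto simp: algebra_simps)
  also have "(\<Sum>j\<le>n. qbin ?q n j * (?q ^ (n - j) * ?w (int (Suc j) - int N))) =
      (\<Sum>j\<le>n. - (fps_X ^ (r + (r + s) * M) * (qbin ?q n j * ?w (int j - int N))))"
  proof (rule sum.cong)
    fix j assume j: "j \<in> {..n}"
    have "nat (int M + 1 - (int (Suc j) - int N)) = n - j"
      using j unfolding n_def by simp
    hence "?w (int j - int N) * fps_X ^ (r + (r + s) * M) = - (?w (int (Suc j) - int N) * ?q ^ (n - j))"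
      using theta_term_up[of "int (Suc j) - int N" M r s, where 'a = 'a] j by (simp add: n_def)
    hence "?q ^ (n - j) * ?w (int (Suc j) - int N) = - (fps_X ^ (r + (r + s) * M) * ?w (int j - int N))"
      by (simp add: mult.commute)
    thus "qbin ?q n j * (?q ^ (n - j) * ?w (int (Suc j) - int N)) =
        - (fps_X ^ (r + (r + s) * M) * (qbin ?q n j * ?w (int j - int N)))"
      by (simp only: mult_minus_right mult.left_commute)
  qed simp
  also have "?w (- int N) + ((\<Sum>j\<le>n. qbin ?q n (Suc j) * ?w (int (Suc j) - int N)) + \<dots>) =
      (\<Sum>j\<le>Suc n. qbin ?q n j * ?w (int j - int N)) +
      (\<Sum>j\<le>n. - (fps_X ^ (r + (r + s) * M) * (qbin ?q n j * ?w (int j - int N))))"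
    using sum.atMost_Suc_shift[of "\<lambda>j. qbin ?q n j * ?w (int j - int N)" n] by simp
  also have "\<dots> = (\<Sum>j\<le>n. qbin ?q n j * ?w (int j - int N)) * (1 - fps_X ^ (r + (r + s) * M))"
    by (simp add: qbin_eq_0 right_diff_distrib left_diff_distrib sum_negf mult.commute flip: sum_distrib_left)
  finally show ?case
    using Suc by (simp add: qpoch_Suc n_def mult_ac)
qed

lemma filterlim_nat_add_int: "filterlim (\<lambda>N. nat (int N + k)) sequentially sequentially"
  unfolding filterlim_at_top
proof
  fix Z
  show "\<forall>\<^sub>F N in sequentially. Z \<le> nat (int N + k)"
    using eventually_ge_at_top[of "Z + nat \<bar>k\<bar>"] by eventually_elim linarith
qed

text \<open>For large \<open>N\<close> the binomial is a quotient of one \<open>qpoch d d\<close> by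
  two others, all of growing length and all tending to \<open>qprod d d\<close>. The extra factor
  cancels the remaining reciprocal.\<close>

lemma central_qbin_tendsto:
  assumes "d > 0"
  shows "(\<lambda>N. qprod d d * qbin (fps_X ^ d) (N + N) (nat (int N + k))) \<longlonglongrightarrow> (1 :: 'a :: field fps)"
proof -
  let ?f = "qprod d d :: 'a fps" and ?p = "\<lambda>N. qpoch d d N :: 'a fps"
  let ?A = "\<lambda>N. nat (int N + k)" and ?C = "\<lambda>N. nat (int N + (- k))"
  have unit: "?p N * inverse (?p N) = 1" for N
    by (rule inverse_mult_eq_1') (simp add: qpoch_nth_0 assms)
  have "(\<lambda>N. inverse (?p (?A N))) \<longlonglongrightarrow> inverse ?f" "(\<lambda>N. inverse (?p (?C N))) \<longlonglongrightarrow> inverse ?f"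
    by (intro tendsto_inverse_fps qpoch_tendsto_compose filterlim_nat_add_int assms;
        simp add: qprod_nth_0 assms)+
  moreover have "(\<lambda>N. ?p (N + N)) \<longlonglongrightarrow> ?f"
    by (intro qpoch_tendsto_compose assms filterlim_subseq) (simp add: strict_mono_def)
  ultimately have lim: "(\<lambda>N. ?f * (?p (N + N) * (inverse (?p (?A N)) * inverse (?p (?C N)))))
      \<longlonglongrightarrow> ?f * (?f * (inverse ?f * inverse ?f))"
    by (intro tendsto_mult_fps tendsto_const)
  have "?f * inverse ?f = 1"
    by (rule inverse_mult_eq_1') (simp add: qprod_nth_0 assms)
  moreover have "?f * (?f * (inverse ?f * inverse ?f)) = (?f * inverse ?f) * (?f * inverse ?f)"
    by (simp only: mult_ac)
  ultimately have "?f * (?f * (inverse ?f * inverse ?f)) = 1"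
    by simp
  note lim = lim[unfolded this]
  have "\<forall>\<^sub>F N in sequentially. ?f * (?p (N + N) * (inverse (?p (?A N)) * inverse (?p (?C N)))) =
      ?f * qbin (fps_X ^ d) (N + N) (?A N)"
    using eventually_ge_at_top[of "nat \<bar>k\<bar>"]
  proof eventually_elim
    case (elim N)
    hence "?A N + ?C N = N + N" by linarith
    hence "?p (N + N) = qbin (fps_X ^ d) (N + N) (?A N) * ?p (?A N) * ?p (?C N)"
      using qbin_mult_qpoch[of d "?A N" "?C N", where 'a = 'a] by simp
    hence "?p (N + N) * (inverse (?p (?A N)) * inverse (?p (?C N))) =
      qbin (fps_X ^ d) (N + N) (?A N) * (?p (?A N) * inverse (?p (?A N))) * (?p (?C N) * inverse (?p (?C N)))"
      by (simp only: mult_ac)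
    thus ?case by (simp only: unit mult_1_right)
  qed
  with lim show ?thesis
    by (rule Lim_transform_eventually)
qed

text \<open>Let both lengths in the finite identity tend to infinity. Coefficient \<open>n\<close>
  sees only the finitely many \<open>k\<close> with exponent at most \<open>n\<close>, so the limit
  may be taken term by term.\<close>

theorem jacobi_triple_product:
  assumes "r > 0" "s > 0"
  shows "qprod r (r + s) * qprod s (r + s) * qprod (r + s) (r + s) = (theta r s :: 'a :: field fps)"
proof -
  let ?q = "fps_X ^ (r + s) :: 'a fps" and ?w = "theta_term r s :: int \<Rightarrow> 'a fps"
  let ?f = "qprod (r + s) (r + s) :: 'a fps" and ?e = "theta_exp r s"
  let ?L = "\<lambda>N. ?f * (qpoch r (r + s) N * qpoch s (r + s) N)"
  let ?c = "\<lambda>N k. ?f * qbin ?q (N + N) (nat (int N + k))"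
  have "?L \<longlonglongrightarrow> ?f * (qprod r (r + s) * qprod s (r + s))"
    using assms by (intro tendsto_mult_fps tendsto_const qpoch_tendsto) simp_all
  moreover have "?L \<longlonglongrightarrow> theta r s"
  proof (rule tendsto_fpsI)
    fix n
    define K where "K = {k. ?e k \<le> n}"
    have finK: "finite K"
      unfolding K_def by (rule finite_theta_exp[OF assms])
    have "\<forall>\<^sub>F N in sequentially. \<forall>k\<in>K. \<forall>i\<in>{..n}. ?c N k $ i = 1 $ i"
      using central_qbin_tendsto[of "r + s", where 'a = 'a] assms
      by (simp add: eventually_ball_finite_distrib finK tendsto_fps_iff)
    moreover have "\<forall>\<^sub>F N in sequentially. N \<ge> n"
      by (rule eventually_ge_at_top)
    ultimately show "\<forall>\<^sub>F N in sequentially. ?L N $ n = theta r s $ n"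
    proof eventually_elim
      case (elim N)
      have K: "K \<subseteq> {- int N..int N}"
      proof
        fix k assume "k \<in> K"
        thus "k \<in> {- int N..int N}"
          using abs_le_theta_exp[OF assms, of k] elim(2) by (auto simp: K_def abs_le_iff)
      qed
      have "?L N = (\<Sum>j\<le>N + N. ?f * qbin ?q (N + N) j * ?w (int j - int N))"
        by (simp add: finite_triple_product sum_distrib_left mult.assoc)
      also have "\<dots> = (\<Sum>k\<in>{- int N..int N}. ?c N k * ?w k)"
        by (rule sum.reindex_bij_witness[of _ "\<lambda>k. nat (int N + k)" "\<lambda>j. int j - int N"]) auto
      finally have "?L N $ n = (\<Sum>k\<in>{- int N..int N}. (?c N k * ?w k) $ n)"
        by (simp add: fps_sum_nth)
      also have "\<dots> = (\<Sum>k\<in>K. (?c N k * ?w k) $ n)"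
        using K by (intro sum.mono_neutral_right)
          (auto simp: K_def theta_term_def fps_X_power_mult_right_nth)
      also have "\<dots> = (\<Sum>k\<in>K. if ?e k = n then (if even k then 1 else -1) else 0)"
      proof (rule sum.cong)
        fix k assume k: "k \<in> K"
        have "?c N k $ (n - ?e k) = 1 $ (n - ?e k)"
          using elim(1) k by simp
        thus "(?c N k * ?w k) $ n = (if ?e k = n then (if even k then 1 else -1) else 0)"
          using k by (auto simp: K_def theta_term_def fps_X_power_mult_right_nth)
      qed simp
      also have "\<dots> = theta r s $ n"
        unfolding theta_def fps_nth_Abs_fps using finK
        by (subst sum.inter_filter[symmetric]) (auto simp: K_def intro!: sum.cong)
      finally show ?case .
    qed
  qed
  ultimately have "?f * (qprod r (r + s) * qprod s (r + s)) = theta r s"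
    by (rule LIMSEQ_unique)
  thus ?thesis by (simp add: mult_ac)
qed

section \<open>The 3-dissection of phi(-q)\<close>

lemma theta_exp_square: "int (theta_exp m m k) = int m * k\<^sup>2"
proof -
  have "theta_exp m m k = m * (tri k + tri (k - 1))"
    by (simp add: theta_exp_def distrib_left)
  thus ?thesis by (simp only: of_nat_mult tri_sum)
qed

text \<open>The right-hand side is m((3k - 1)^2 - 1), which accounts for the squares of integers
  prime to 3.\<close>

lemma theta_exp_3_15: "int (theta_exp (3 * m) (15 * m) k) = int m * (9 * k\<^sup>2 - 6 * k)"
proof -
  have "int (tri k) = int (tri (k - 1)) + k" "int (tri k) + int (tri (k - 1)) = k\<^sup>2"
    using tri_diff[of k] tri_sum[of k] by simp_all
  hence "3 * int (tri k) + 15 * int (tri (k - 1)) = 9 * k\<^sup>2 - 6 * k"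
    by simp
  moreover have "int (theta_exp (3 * m) (15 * m) k) = int m * (3 * int (tri k) + 15 * int (tri (k - 1)))"
    by (simp add: theta_exp_def algebra_simps)
  ultimately show ?thesis by simp
qed

text \<open>Split the sum of (-1)^k q^(m k^2) by \<open>k\<close> modulo 3. Multiples of 3 give the
  first theta series. The other indices are 3j - 1 and 1 - 3j, with equal squares and sign opposite
  to (-1)^j, hence the factor -2.\<close>

lemma theta_dissection:
  assumes "m > 0"
  shows "theta m m = theta (9 * m) (9 * m) - 2 * fps_X ^ m * (theta (3 * m) (15 * m) :: 'a :: field fps)"
proof (rule fps_ext)
  fix n
  let ?g = "\<lambda>k::int. if even k then 1 else -1 :: 'a"
  let ?A = "{j. theta_exp (9 * m) (9 * m) j = n}" and ?C = "{j. m + theta_exp (3 * m) (15 * m) j = n}"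
  have e0: "theta_exp m m (3 * j) = theta_exp (9 * m) (9 * m) j" for j
    by (subst of_nat_eq_iff[where 'a = int, symmetric])
      (simp add: theta_exp_square power2_eq_square)
  have e1: "theta_exp m m (3 * j - 1) = m + theta_exp (3 * m) (15 * m) j" for j
    by (subst of_nat_eq_iff[where 'a = int, symmetric])
      (simp only: of_nat_add theta_exp_square theta_exp_3_15, simp add: power2_eq_square algebra_simps)
  have e2: "theta_exp m m (1 - 3 * j) = m + theta_exp (3 * m) (15 * m) j" for j
    by (subst of_nat_eq_iff[where 'a = int, symmetric])
      (simp only: of_nat_add theta_exp_square theta_exp_3_15, simp add: power2_eq_square algebra_simps)
  have fin: "finite {k. theta_exp r s k = n}" if "r > 0" "s > 0" for r s
    by (rule finite_subset[OF _ finite_theta_exp[OF that, of n]]) auto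
  have finA: "finite ?A" using fin assms by simp
  have finC: "finite ?C"
    by (rule finite_subset[OF _ finite_theta_exp[of "3 * m" "15 * m" n]]) (use assms in auto)
  have split: "{k. theta_exp m m k = n} = (*) 3 ` ?A \<union> ((\<lambda>j. 3 * j - 1) ` ?C \<union> (\<lambda>j. 1 - 3 * j) ` ?C)"
    (is "?S = ?R")
  proof
    show "?R \<subseteq> ?S" by (auto simp: e0 e1 e2)
    show "?S \<subseteq> ?R"
    proof
      fix k assume k: "k \<in> ?S"
      have "k = 3 * (k div 3) \<or> k = 3 * ((k + 1) div 3) - 1 \<or> k = 1 - 3 * ((1 - k) div 3)"
        by presburger
      thus "k \<in> ?R"
      proof (elim disjE)
        assume *: "k = 3 * (k div 3)"
        hence "k div 3 \<in> ?A" using k e0[of "k div 3"] by simp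
        thus ?thesis using * by blast
      next
        assume *: "k = 3 * ((k + 1) div 3) - 1"
        hence "(k + 1) div 3 \<in> ?C" using k e1[of "(k + 1) div 3"] by simp
        thus ?thesis using * by blast
      next
        assume *: "k = 1 - 3 * ((1 - k) div 3)"
        hence "(1 - k) div 3 \<in> ?C" using k e2[of "(1 - k) div 3"] by simp
        thus ?thesis using * by blast
      qed
    qed
  qed
  have "theta m m $ n = sum ?g ?R"
    unfolding theta_def fps_nth_Abs_fps split ..
  also have "\<dots> = sum ?g ((*) 3 ` ?A) + (sum ?g ((\<lambda>j. 3 * j - 1) ` ?C) + sum ?g ((\<lambda>j. 1 - 3 * j) ` ?C))"
  proof -
    have "3 * i \<noteq> 3 * j - 1" "3 * i \<noteq> 1 - 3 * j" "3 * i - 1 \<noteq> 1 - 3 * j" for i j :: int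
      by presburger+
    hence "(*) 3 ` ?A \<inter> ((\<lambda>j. 3 * j - 1) ` ?C \<union> (\<lambda>j. 1 - 3 * j) ` ?C) = {}"
      "(\<lambda>j. 3 * j - 1) ` ?C \<inter> (\<lambda>j. 1 - 3 * j) ` ?C = {}"
      by blast+
    thus ?thesis using finA finC by (simp add: sum.union_disjoint)
  qed
  also have "sum ?g ((*) 3 ` ?A) = sum ?g ?A"
    by (subst sum.reindex) (auto simp: inj_on_def)
  also have "sum ?g ((\<lambda>j. 3 * j - 1) ` ?C) = (\<Sum>j\<in>?C. - ?g j)"
    by (subst sum.reindex) (auto simp: inj_on_def intro!: sum.cong)
  also have "sum ?g ((\<lambda>j. 1 - 3 * j) ` ?C) = (\<Sum>j\<in>?C. - ?g j)"
    by (subst sum.reindex) (auto simp: inj_on_def intro!: sum.cong)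
  also have "sum ?g ?A + ((\<Sum>j\<in>?C. - ?g j) + (\<Sum>j\<in>?C. - ?g j)) = sum ?g ?A - 2 * sum ?g ?C"
    by (simp add: sum_negf)
  also have "sum ?g ?A = theta (9 * m) (9 * m) $ n"
    by (simp add: theta_def)
  also have "sum ?g ?C = (fps_X ^ m * theta (3 * m) (15 * m)) $ n"
  proof (cases "m \<le> n")
    case True
    hence "?C = {j. theta_exp (3 * m) (15 * m) j = n - m}" by auto
    with True show ?thesis by (simp add: theta_def fps_X_power_mult_nth)
  next
    case False
    hence "?C = {}" by auto
    with False show ?thesis by (simp add: fps_X_power_mult_nth)
  qed
  finally show "theta m m $ n =
      (theta (9 * m) (9 * m) - 2 * fps_X ^ m * theta (3 * m) (15 * m) :: 'a fps) $ n"
    by (simp add: numeral_fps_const mult.assoc)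
qed

section \<open>Generating functions of partitions\<close>

text \<open>\<open>card\<close> counts an infinite fibre of \<open>w\<close> as 0, so products of
  such series require finite fibres.\<close>

definition count_fps :: "'b set \<Rightarrow> ('b \<Rightarrow> nat) \<Rightarrow> 'a :: field fps" where
  "count_fps W w = Abs_fps (\<lambda>n. of_nat (card {p\<in>W. w p = n}))"

lemma count_fps_Times:
  assumes "\<And>n. finite {p\<in>A. w p = n}" "\<And>n. finite {p\<in>B. v p = n}"
  shows "count_fps (A \<times> B) (\<lambda>(p, q). w p + v q) = count_fps A w * count_fps B v"
proof (rule fps_ext)
  fix n
  let ?S = "\<lambda>i. {p\<in>A. w p = i} \<times> {p\<in>B. v p = n - i}"
  have "{x\<in>A \<times> B. (\<lambda>(p, q). w p + v q) x = n} = (\<Union>i\<in>{0..n}. ?S i)"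
    by auto
  moreover have "card (\<Union>i\<in>{0..n}. ?S i) = (\<Sum>i=0..n. card (?S i))"
    using assms by (intro card_UN_disjoint) auto
  ultimately show "count_fps (A \<times> B) (\<lambda>(p, q). w p + v q) $ n = (count_fps A w * count_fps B v) $ n"
    by (simp add: count_fps_def fps_mult_nth card_cartesian_product)
qed

definition mults :: "nat set \<Rightarrow> nat multiset set" where
  "mults S = {p. set_mset p \<subseteq> S}"

definition dmults :: "nat set \<Rightarrow> nat multiset set" where
  "dmults S = {p. set_mset p \<subseteq> S \<and> (\<forall>x. count p x \<le> 1)}"

lemma member_le_sum_mset: "x \<in># p \<Longrightarrow> x \<le> sum_mset p" for x :: nat
  by (auto dest!: multi_member_split)

lemma size_le_sum_mset:
  assumes "0 \<notin># p"
  shows "size p \<le> sum_mset p"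
  using assms by (induction p) auto

lemma finite_mults:
  assumes "0 \<notin> S"
  shows "finite {p\<in>mults S. sum_mset p = n}"
proof (rule finite_subset)
  show "finite (mset ` {xs. set xs \<subseteq> {..n} \<and> length xs \<le> n})"
    by (intro finite_imageI finite_lists_length_le) simp
  show "{p\<in>mults S. sum_mset p = n} \<subseteq> mset ` {xs. set xs \<subseteq> {..n} \<and> length xs \<le> n}"
  proof
    fix p assume p: "p \<in> {p\<in>mults S. sum_mset p = n}"
    obtain xs where xs: "mset xs = p" using ex_mset by blast
    have "set xs \<subseteq> {..n}"
      using p member_le_sum_mset[of _ p] xs by auto
    moreover have "0 \<notin># p"
      using p assms by (auto simp: mults_def)
    hence "length xs \<le> n"
      using size_le_sum_mset[of p] p xs by auto
    ultimately show "p \<in> mset ` {xs. set xs \<subseteq> {..n} \<and> length xs \<le> n}"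
      using xs by blast
  qed
qed

lemma finite_dmults: "0 \<notin> S \<Longrightarrow> finite {p\<in>dmults S. sum_mset p = n}"
  by (rule finite_subset[OF _ finite_mults[of S n]]) (auto simp: mults_def dmults_def)

text \<open>Parts larger than \<open>n\<close> cannot occur in a partition of \<open>n\<close>. This
  reduces infinite sets of parts to finite ones.\<close>

lemma mults_nth_cong:
  assumes "S \<inter> {..n} = T \<inter> {..n}"
  shows "count_fps (mults S) sum_mset $ n = count_fps (mults T) sum_mset $ n"
proof -
  have "{p\<in>mults S. sum_mset p = n} = {p\<in>mults T. sum_mset p = n}"
    using assms member_le_sum_mset by (fastforce simp: mults_def)
  thus ?thesis by (simp add: count_fps_def)
qed

lemma dmults_nth_cong:
  assumes "S \<inter> {..n} = T \<inter> {..n}"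
  shows "count_fps (dmults S) sum_mset $ n = count_fps (dmults T) sum_mset $ n"
proof -
  have "{p\<in>dmults S. sum_mset p = n} = {p\<in>dmults T. sum_mset p = n}"
    using assms member_le_sum_mset by (fastforce simp: dmults_def)
  thus ?thesis by (simp add: count_fps_def)
qed

lemma count_fps_mults_empty [simp]: "count_fps (mults {}) sum_mset = 1"
  and count_fps_dmults_empty [simp]: "count_fps (dmults {}) sum_mset = 1"
proof -
  have "{p :: nat multiset. p = {#} \<and> sum_mset p = n} = (if n = 0 then {{#}} else {})" for n
    by auto
  moreover have "mults {} = {{#}}" "dmults {} = {{#}}"
    by (auto simp: mults_def dmults_def)
  ultimately show "count_fps (mults {}) sum_mset = 1" "count_fps (dmults {}) sum_mset = 1"
    by (auto simp: count_fps_def fps_eq_iff)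
qed

text \<open>A partition either avoids \<open>a\<close> or arises by adding one \<open>a\<close> to a
  partition that may contain further copies: G' = G + q^a G', where G' allows the part
  \<open>a\<close> and G does not.\<close>

lemma count_fps_mults_insert:
  assumes "a \<notin> S" "a > 0" "0 \<notin> S"
  shows "count_fps (mults (insert a S)) sum_mset * (1 - fps_X ^ a) = count_fps (mults S) sum_mset"
proof (rule fps_ext)
  fix n
  let ?N = "\<lambda>S n. {p\<in>mults S. sum_mset p = n}"
  have fin: "finite (?N S n)" "finite (?N (insert a S) n)" for n
    using assms by (intro finite_mults; simp)+
  have card: "card (?N (insert a S) n) = card (?N S n) + (if a \<le> n then card (?N (insert a S) (n - a)) else 0)"
  proof (cases "a \<le> n")
    case True
    have "?N (insert a S) n = ?N S n \<union> add_mset a ` ?N (insert a S) (n - a)" (is "?L = ?R")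
    proof
      show "?R \<subseteq> ?L" using True by (auto simp: mults_def)
      show "?L \<subseteq> ?R"
      proof
        fix p assume p: "p \<in> ?L"
        show "p \<in> ?R"
        proof (cases "a \<in># p")
          case True
          then obtain q where q: "p = add_mset a q" by (auto dest: multi_member_split)
          with p have "q \<in> ?N (insert a S) (n - a)" by (auto simp: mults_def)
          thus ?thesis using q by blast
        next
          case False
          thus ?thesis using p by (auto simp: mults_def)
        qed
      qed
    qed
    moreover have "add_mset a q \<notin> ?N S n" for q
      using assms(1) by (simp add: mults_def)
    hence "?N S n \<inter> add_mset a ` ?N (insert a S) (n - a) = {}"
      by blast
    ultimately show ?thesis
      using True fin by (simp add: card_Un_disjoint card_image inj_on_def)
  next
    case False
    have "a \<notin># p" if "sum_mset p = n" for p
      using member_le_sum_mset[of a p] that False by auto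
    hence "p \<in> ?N (insert a S) n \<longleftrightarrow> p \<in> ?N S n" for p
      by (cases "sum_mset p = n") (simp_all add: mults_def subset_insert)
    hence "?N (insert a S) n = ?N S n"
      by blast
    thus ?thesis using False by simp
  qed
  show "(count_fps (mults (insert a S)) sum_mset * (1 - fps_X ^ a)) $ n = count_fps (mults S) sum_mset $ n"
    using card by (auto simp: count_fps_def right_diff_distrib fps_X_power_mult_right_nth)
qed

text \<open>With distinct parts no further copy remains once \<open>a\<close> is removed: G' = G +
  q^a G.\<close>

lemma count_fps_dmults_insert:
  assumes "a \<notin> S" "a > 0" "0 \<notin> S"
  shows "count_fps (dmults (insert a S)) sum_mset = count_fps (dmults S) sum_mset * (1 + fps_X ^ a)"
proof (rule fps_ext)
  fix n
  let ?N = "\<lambda>S n. {p\<in>dmults S. sum_mset p = n}"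
  have fin: "finite (?N S n)" for n
    using assms by (intro finite_dmults)
  have card: "card (?N (insert a S) n) = card (?N S n) + (if a \<le> n then card (?N S (n - a)) else 0)"
  proof (cases "a \<le> n")
    case True
    have "?N (insert a S) n = ?N S n \<union> add_mset a ` ?N S (n - a)" (is "?L = ?R")
    proof
      have "count p a = 0" if "p \<in> dmults S" for p
        using that assms(1) by (auto simp: dmults_def count_eq_zero_iff)
      thus "?R \<subseteq> ?L" using True by (auto simp: dmults_def)
      show "?L \<subseteq> ?R"
      proof
        fix p assume p: "p \<in> ?L"
        show "p \<in> ?R"
        proof (cases "a \<in># p")
          case True
          then obtain q where q: "p = add_mset a q" by (auto dest: multi_member_split)
          have c: "count p x \<le> 1" for x using p by (auto simp: dmults_def)
          have "count q x \<le> 1" for x using c[of x] by (auto simp: q split: if_splits)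
          moreover have "a \<notin># q" using c[of a] by (simp add: q count_eq_zero_iff)
          ultimately have "q \<in> ?N S (n - a)" using p q by (auto simp: dmults_def)
          thus ?thesis using q by blast
        next
          case False
          thus ?thesis using p by (auto simp: dmults_def)
        qed
      qed
    qed
    moreover have "add_mset a q \<notin> ?N S n" for q
      using assms(1) by (simp add: dmults_def)
    hence "?N S n \<inter> add_mset a ` ?N S (n - a) = {}"
      by blast
    ultimately show ?thesis
      using True fin by (simp add: card_Un_disjoint card_image inj_on_def)
  next
    case False
    have "a \<notin># p" if "sum_mset p = n" for p
      using member_le_sum_mset[of a p] that False by auto
    hence "p \<in> ?N (insert a S) n \<longleftrightarrow> p \<in> ?N S n" for p
      by (cases "sum_mset p = n") (simp_all add: dmults_def subset_insert)
    hence "?N (insert a S) n = ?N S n"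
      by blast
    thus ?thesis using False by simp
  qed
  show "count_fps (dmults (insert a S)) sum_mset $ n = (count_fps (dmults S) sum_mset * (1 + fps_X ^ a)) $ n"
    using card by (auto simp: count_fps_def distrib_left fps_X_power_mult_right_nth)
qed

lemma count_fps_multiples:
  assumes "d > 0"
  shows "count_fps (mults {x. d dvd x \<and> 0 < x}) sum_mset * qprod d d = (1 :: 'a :: field fps)"
proof -
  let ?T = "\<lambda>N. (\<lambda>i. d + d * i) ` {..<N}" and ?S = "{x. d dvd x \<and> 0 < x}"
  let ?G = "\<lambda>S. count_fps (mults S) sum_mset :: 'a fps"
  have fin: "?G (?T N) * qpoch d d N = 1" for N
  proof (induction N)
    case (Suc N)
    have "?G (?T (Suc N)) * (1 - fps_X ^ (d + d * N)) = ?G (?T N)"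
      unfolding lessThan_Suc image_insert
      by (rule count_fps_mults_insert) (use assms in auto)
    with Suc show ?case by (simp add: qpoch_Suc mult.assoc mult.left_commute mult.commute)
  qed simp
  have "(\<lambda>N. ?G (?T N)) \<longlonglongrightarrow> ?G ?S"
  proof (rule tendsto_fpsI)
    fix n
    show "\<forall>\<^sub>F N in sequentially. ?G (?T N) $ n = ?G ?S $ n"
      using eventually_gt_at_top[of n]
    proof eventually_elim
      case (elim N)
      show ?case
      proof (rule mults_nth_cong)
        show "?T N \<inter> {..n} = ?S \<inter> {..n}"
        proof
          show "?T N \<inter> {..n} \<subseteq> ?S \<inter> {..n}" using assms by auto
          show "?S \<inter> {..n} \<subseteq> ?T N \<inter> {..n}"
          proof
            fix x assume x: "x \<in> ?S \<inter> {..n}"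
            then obtain c where c: "x = d * c" "c > 0" by auto
            have "c \<le> x" using c assms by simp
            hence "c - 1 < N" using x elim by auto
            moreover have "x = d + d * (c - 1)" using c by (cases c) auto
            ultimately show "x \<in> ?T N \<inter> {..n}" using x by blast
          qed
        qed
      qed
    qed
  qed
  hence "(\<lambda>N. ?G (?T N) * qpoch d d N) \<longlonglongrightarrow> ?G ?S * qprod d d"
    using assms by (intro tendsto_mult_fps qpoch_tendsto)
  thus ?thesis
    unfolding fin by (simp add: LIMSEQ_const_iff)
qed

text \<open>Distinct odd parts give the product of all 1 + q^(2i+1); multiplying each factor by 1 -
  q^(2i+1) leaves 1 - q^(4i+2).\<close>

lemma count_fps_distinct_odd:
  "count_fps (dmults {x. odd x}) sum_mset * qprod 1 2 = (qprod 2 4 :: 'a :: field fps)"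
proof -
  let ?T = "\<lambda>N. (\<lambda>i. 1 + 2 * i) ` {..<N}" and ?S = "{x :: nat. odd x}"
  let ?G = "\<lambda>S. count_fps (dmults S) sum_mset :: 'a fps"
  have fin: "?G (?T N) * qpoch 1 2 N = qpoch 2 4 N" for N
  proof (induction N)
    case (Suc N)
    have "?G (?T (Suc N)) = ?G (?T N) * (1 + fps_X ^ (1 + 2 * N))"
      unfolding lessThan_Suc image_insert by (rule count_fps_dmults_insert) auto
    hence "?G (?T (Suc N)) * qpoch 1 2 (Suc N) = (?G (?T N) * qpoch 1 2 N) *
        ((1 + fps_X ^ (1 + 2 * N)) * (1 - fps_X ^ (1 + 2 * N)))"
      by (simp only: qpoch_Suc mult_ac)
    also have "(1 + fps_X ^ (1 + 2 * N)) * (1 - fps_X ^ (1 + 2 * N)) = (1 - fps_X ^ (2 + 4 * N) :: 'a fps)"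
      by (simp add: algebra_simps flip: power_add)
    finally show ?case using Suc by (simp add: qpoch_Suc[of 2 4])
  qed simp
  have "(\<lambda>N. ?G (?T N)) \<longlonglongrightarrow> ?G ?S"
  proof (rule tendsto_fpsI)
    fix n
    show "\<forall>\<^sub>F N in sequentially. ?G (?T N) $ n = ?G ?S $ n"
      using eventually_gt_at_top[of n]
    proof eventually_elim
      case (elim N)
      show ?case
        by (rule dmults_nth_cong) (use elim in \<open>auto elim!: oddE\<close>)
    qed
  qed
  hence "(\<lambda>N. ?G (?T N) * qpoch 1 2 N) \<longlonglongrightarrow> ?G ?S * qprod 1 2"
    by (intro tendsto_mult_fps qpoch_tendsto) simp_all
  moreover have "(\<lambda>N. ?G (?T N) * qpoch 1 2 N) \<longlonglongrightarrow> qprod 2 4"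
    unfolding fin by (rule qpoch_tendsto) simp
  ultimately show ?thesis
    by (rule LIMSEQ_unique)
qed

text \<open>The three partitions contribute (q^2; q^4) / (q; q^2), 1 / f_4 and 1 / f_4 as infinite
  products. The splittings f_1 = (q; q^2) f_2 and f_2 = (q^2; q^4) f_4 give the rest.\<close>

lemma b_generating_function:
  "Abs_fps (\<lambda>n. of_nat (b n)) * qprod 1 1 * qprod 4 4 ^ 3 = (qprod 2 2 ^ 2 :: 'a :: field fps)"
proof -
  let ?O = "dmults {x. odd x}" and ?F = "mults {x. 4 dvd x \<and> 0 < x}"
  let ?f = "\<lambda>m. qprod m m :: 'a fps" and ?w = "sum_mset :: nat multiset \<Rightarrow> nat"
  have finF: "finite {p\<in>?F. sum_mset p = n}" and finO: "finite {p\<in>?O. sum_mset p = n}" for n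
    by (intro finite_mults finite_dmults; simp)+
  have finFF: "finite {x\<in>?F \<times> ?F. (\<lambda>(p, q). ?w p + ?w q) x = n}" for n
    by (rule finite_subset[of _ "(\<Union>i\<in>{..n}. \<Union>j\<in>{..n}. {p\<in>?F. ?w p = i} \<times> {p\<in>?F. ?w p = j})"])
       (use finF in auto)
  have "b n = card {x\<in>?O \<times> (?F \<times> ?F). (\<lambda>(p, q). ?w p + (\<lambda>(p, q). ?w p + ?w q) q) x = n}" for n
    unfolding b_def
    by (rule arg_cong[of _ _ card])
       (auto simp: mults_def dmults_def is_partition_def psize_def subset_iff intro: odd_pos)
  hence "Abs_fps (\<lambda>n. of_nat (b n)) =
      (count_fps (?O \<times> (?F \<times> ?F)) (\<lambda>(p, q). ?w p + (\<lambda>(p, q). ?w p + ?w q) q) :: 'a fps)"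
    by (simp only: count_fps_def)
  also have "\<dots> = count_fps ?O ?w * (count_fps ?F ?w * count_fps ?F ?w)"
    by (simp only: count_fps_Times[OF finF finF] count_fps_Times[OF finO finFF])
  finally have B: "Abs_fps (\<lambda>n. of_nat (b n)) = count_fps ?O ?w * (count_fps ?F ?w * count_fps ?F ?w :: 'a fps)" .
  have O: "count_fps ?O ?w * qprod 1 2 = (qprod 2 4 :: 'a fps)"
    by (rule count_fps_distinct_odd)
  have F: "count_fps ?F ?w * ?f 4 = 1"
    by (rule count_fps_multiples) simp
  have f1: "?f 1 = qprod 1 2 * ?f 2"
    using qprod_split2[of 1 1, where 'a = 'a] by (simp only: one_add_one mult_1_right zero_less_one)
  have f2: "qprod 2 4 * ?f 4 = ?f 2"
    using qprod_split2[of 2 2, where 'a = 'a] by simp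
  have "Abs_fps (\<lambda>n. of_nat (b n)) * ?f 1 * ?f 4 ^ 3 =
      (count_fps ?O ?w * qprod 1 2) * (count_fps ?F ?w * ?f 4) * (count_fps ?F ?w * ?f 4) * ?f 4 * ?f 2"
    unfolding B f1 by (simp only: mult_ac power3_eq_cube)
  also have "\<dots> = (qprod 2 4 * ?f 4) * ?f 2"
    by (simp only: O F mult_1_right)
  also have "\<dots> = ?f 2 ^ 2"
    by (simp only: f2 power2_eq_square)
  finally show ?thesis .
qed

section \<open>Power series over the field with three elements\<close>

text \<open>An index type: the modulus of \<open>mod_ring\<close> is the cardinality of its
  argument, so \<open>three mod_ring\<close> is GF(3).\<close>

datatype three = Three0 | Three1 | Three2

lemma UNIV_three: "UNIV = {Three0, Three1, Three2}"
  using three.exhaust by blast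

lemma CARD_three: "CARD(three) = 3"
  by (simp add: UNIV_three)

instance three :: prime_card
  by standard (simp add: CARD_three)

type_synonym gf3 = "three mod_ring"

lemma CHAR_gf3: "CHAR(gf3) = 3"
  by (simp add: CARD_three)

lemma three_eq_0_gf3_fps: "(3 :: gf3 fps) = 0"
  using of_nat_CHAR[where 'a = "gf3 fps"] by (simp add: CARD_three)

lemma gf3_cases: "c = 0 \<or> c = 1 \<or> c = -1" for c :: gf3
proof -
  obtain i where "i < 3" "c = of_nat i"
    using surj_of_nat_mod_ring[of c] by (auto simp: CARD_three)
  moreover have "(2 :: gf3) = -1"
    using of_nat_CHAR[where 'a = gf3] by (simp add: CARD_three eq_neg_iff_add_eq_0)
  ultimately show ?thesis
    by (auto simp: less_Suc_eq numeral_3_eq_3 numeral_2_eq_2)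
qed

lemma cube_add_gf3_fps: "(f + g) ^ 3 = f ^ 3 + g ^ 3" for f g :: "gf3 fps"
proof -
  have "(f + g) ^ 3 = f ^ 3 + g ^ 3 + 3 * (f ^ 2 * g + f * g ^ 2)"
    by (simp add: power3_eq_cube power2_eq_square algebra_simps)
  thus ?thesis by (simp add: three_eq_0_gf3_fps)
qed

section \<open>Dissection of power series by exponents modulo 3\<close>

definition sect :: "nat \<Rightarrow> 'a :: zero fps \<Rightarrow> 'a fps" where
  "sect r f = Abs_fps (\<lambda>n. f $ (3 * n + r))"

lemma sect_nth [simp]: "sect r f $ n = f $ (3 * n + r)"
  by (simp add: sect_def)

lemma sect_add: "sect r (f + g) = sect r f + sect r g" for f :: "'a :: field fps"
  by (simp add: fps_eq_iff)

lemma sect_X_power: "r < 3 \<Longrightarrow> i < 3 \<Longrightarrow> sect r (fps_X ^ i :: gf3 fps) = (if i = r then 1 else 0)"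
  by (auto simp: fps_eq_iff fps_X_power_nth)

text \<open>Over GF(3) the series \<open>h ^ 3\<close> is h(q^3), so it leaves the section as
  \<open>h\<close>. Peeling off the constant coefficient of \<open>h\<close>, which cubing fixes,
  yields the same recursion for both sides; induction on the coefficient index concludes.\<close>

lemma sect_cube_mult:
  fixes f h :: "gf3 fps"
  assumes "r < 3"
  shows "sect r (h ^ 3 * f) = h * sect r f"
proof (rule fps_ext)
  have split: "sect r (h ^ 3 * f) = fps_const (h $ 0) * sect r f + fps_X * sect r (fps_shift 1 h ^ 3 * f)"
    "h * sect r f = fps_const (h $ 0) * sect r f + fps_X * (fps_shift 1 h * sect r f)" for h
  proof -
    have h: "h = fps_const (h $ 0) + fps_X * fps_shift 1 h"
      by (auto simp: fps_eq_iff)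
    have "(h $ 0) ^ 3 = h $ 0"
      using gf3_cases[of "h $ 0"] by auto
    hence "h ^ 3 = fps_const (h $ 0) + fps_X ^ 3 * fps_shift 1 h ^ 3"
      by (subst h) (simp add: cube_add_gf3_fps power_mult_distrib fps_const_power del: fps_const_add)
    hence "h ^ 3 * f = fps_const (h $ 0) * f + fps_X ^ 3 * (fps_shift 1 h ^ 3 * f)"
      by (simp add: distrib_right mult.assoc)
    moreover have "sect r (fps_X ^ 3 * g) = fps_X * sect r g" for g :: "gf3 fps"
    proof (rule fps_ext)
      fix n
      show "sect r (fps_X ^ 3 * g) $ n = (fps_X * sect r g) $ n"
        using assms by (cases n) (simp_all add: fps_X_power_mult_nth)
    qed
    ultimately show "sect r (h ^ 3 * f) = fps_const (h $ 0) * sect r f + fps_X * sect r (fps_shift 1 h ^ 3 * f)"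
      by (simp add: sect_add) (simp add: fps_eq_iff)
    show "h * sect r f = fps_const (h $ 0) * sect r f + fps_X * (fps_shift 1 h * sect r f)"
      by (subst h) (simp add: distrib_right mult.assoc)
  qed
  fix n
  show "sect r (h ^ 3 * f) $ n = (h * sect r f) $ n"
  proof (induction n arbitrary: h)
    case (0 h)
    show ?case using split[of h] by simp
  next
    case (Suc n h)
    show ?case using split[of h] Suc[of "fps_shift 1 h"] by simp
  qed
qed

text \<open>Cubes are series in q^3, so the three summands collect the exponents 0, 1 and 2 modulo
  3. The factor \<open>h ^ 3\<close> serves to clear denominators.\<close>

lemma sect_eqI:
  fixes f h g0 g1 g2 :: "gf3 fps"
  assumes "f * h ^ 3 = g0 ^ 3 + fps_X * g1 ^ 3 + fps_X ^ 2 * g2 ^ 3"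
  shows "h * sect 0 f = g0" "h * sect 1 f = g1" "h * sect 2 f = g2"
proof -
  have "h * sect r f = g0 * sect r (fps_X ^ 0) + g1 * sect r (fps_X ^ 1) + g2 * sect r (fps_X ^ 2)"
    if r: "r < 3" for r
  proof -
    have "h * sect r f = sect r (h ^ 3 * f)"
      by (rule sect_cube_mult[OF r, symmetric])
    also have "h ^ 3 * f = g0 ^ 3 * fps_X ^ 0 + g1 ^ 3 * fps_X ^ 1 + g2 ^ 3 * fps_X ^ 2"
      using assms by (simp add: mult.commute)
    also have "sect r \<dots> = g0 * sect r (fps_X ^ 0) + g1 * sect r (fps_X ^ 1) + g2 * sect r (fps_X ^ 2)"
      by (simp only: sect_add sect_cube_mult[OF r])
    finally show ?thesis .
  qed
  from this[of 0] this[of 1] this[of 2]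
  show "h * sect 0 f = g0" "h * sect 1 f = g1" "h * sect 2 f = g2"
    by (simp_all add: sect_X_power del: power_0 power_one_right One_nat_def)
qed

section \<open>Relations among the products f_m modulo 3\<close>

lemma cube_diff_gf3_fps: "(f - g) ^ 3 = f ^ 3 - g ^ 3" for f g :: "gf3 fps"
  using cube_add_gf3_fps[of f "- g"] by simp

lemma qprod_triple: 
  assumes "m > 0"
  shows "qprod (3 * m) (3 * m) = (qprod m m :: gf3 fps) ^ 3"
proof (rule LIMSEQ_unique)
  show "qpoch (3 * m) (3 * m) \<longlonglongrightarrow> (qprod (3 * m) (3 * m) :: gf3 fps)"
    using assms by (intro qpoch_tendsto) simp
  have "qpoch (3 * m) (3 * m) = (\<lambda>N. (qpoch m m N :: gf3 fps) ^ 3)"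
  proof
    fix N
    show "qpoch (3 * m) (3 * m) N = (qpoch m m N :: gf3 fps) ^ 3"
    proof (induction N)
      case (Suc N)
      have "(fps_X ^ (m + m * N)) ^ 3 = (fps_X ^ (3 * m + 3 * m * N) :: gf3 fps)"
        by (simp add: algebra_simps flip: power_mult)
      with Suc show ?case
        by (simp only: qpoch_Suc power_mult_distrib cube_diff_gf3_fps power_one)
    qed simp
  qed
  thus "qpoch (3 * m) (3 * m) \<longlonglongrightarrow> (qprod m m :: gf3 fps) ^ 3"
    using assms by (simp only: tendsto_power_fps qpoch_tendsto)
qed

text \<open>By the triple product, and since tripling the index cubes f_m in characteristic 3, each
  theta series in the dissection is a Laurent monomial in \<open>y\<close> and \<open>?p\<close>,
  the quotient of \<open>x\<close> by \<open>y\<close>.\<close>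

lemma theta_identity:
  assumes "m > 0"
  defines "x \<equiv> qprod m m :: gf3 fps" and "y \<equiv> qprod (2 * m) (2 * m)"
  shows "x ^ 8 * y ^ 8 = x ^ 24 + fps_X ^ m * y ^ 24"
proof -
  let ?A = "qprod (3 * m) (18 * m) :: gf3 fps" and ?C = "qprod (15 * m) (18 * m) :: gf3 fps"
  let ?p = "qprod m (2 * m) :: gf3 fps" and ?p9 = "qprod (9 * m) (18 * m) :: gf3 fps"
  have f3: "qprod (3 * m) (3 * m) = x ^ 3" and f6: "qprod (6 * m) (6 * m) = y ^ 3"
    unfolding x_def y_def using qprod_triple[of m] qprod_triple[of "2 * m"] assms(1) by simp_all
  have f9: "qprod (9 * m) (9 * m) = x ^ 9" and f18: "qprod (18 * m) (18 * m) = y ^ 9"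
    using qprod_triple[of "3 * m"] qprod_triple[of "6 * m"] assms(1)
    by (simp_all add: f3 f6 flip: power_mult)
  have nz: "x \<noteq> 0" "y \<noteq> 0"
    unfolding x_def y_def using assms(1) by (auto intro!: qprod_nonzero)
  have x: "x = ?p * y"
    unfolding x_def y_def using qprod_split2[of m m] assms(1) by (simp add: mult_2)
  have "x ^ 9 = ?p9 * y ^ 9"
    using qprod_split2[of "9 * m" "9 * m", where 'a = gf3] assms(1) by (simp add: f9 f18)
  hence p9: "?p9 = ?p ^ 9"
    using nz x by (simp add: power_mult_distrib)
  have "x ^ 3 = qprod (3 * m) (6 * m) * y ^ 3"
    using qprod_split2[of "3 * m" "3 * m", where 'a = gf3] assms(1) by (simp add: f3 f6)
  hence "?p ^ 3 = qprod (3 * m) (6 * m)"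
    using nz x by (simp add: power_mult_distrib)
  \<comment> \<open>The exponents congruent to 3m modulo 6m split into 3m, 9m and 15m modulo 18m.
    With \<open>?p9 = ?p ^ 9\<close> this makes \<open>?A * ?C\<close> the inverse of
    \<open>?p ^ 6\<close>.\<close>
  also have "\<dots> = ?A * ?p9 * ?C"
    using qprod_split3[of "6 * m" "3 * m", where 'a = gf3] assms(1) by (simp add: algebra_simps)
  also have "\<dots> = ?p ^ 3 * (?A * ?C * ?p ^ 6)"
    unfolding p9 by (simp add: algebra_simps flip: power_add)
  finally have AC: "?A * ?C * ?p ^ 6 = 1"
    using nz x by auto
  have t1: "theta m m = ?p ^ 2 * y"
    using jacobi_triple_product[of m m, where 'a = gf3] assms(1)
    by (simp add: y_def power2_eq_square mult_2)
  have t9: "theta (9 * m) (9 * m) = ?p ^ 18 * y ^ 9"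
    using jacobi_triple_product[of "9 * m" "9 * m", where 'a = gf3] assms(1)
    by (simp add: p9 f18 flip: power_add)
  have t3: "theta (3 * m) (15 * m) = ?A * ?C * y ^ 9"
    using jacobi_triple_product[of "3 * m" "15 * m", where 'a = gf3] assms(1)
    by (simp add: f18)
  have minus2: "- 2 = (1 :: gf3 fps)"
    using three_eq_0_gf3_fps by (simp add: neg_eq_iff_add_eq_0)
  have "theta m m = theta (9 * m) (9 * m) + (- 2) * (fps_X ^ m * (theta (3 * m) (15 * m) :: gf3 fps))"
    by (subst theta_dissection[OF assms(1)]) (simp add: mult.assoc)
  hence "?p ^ 2 * y = ?p ^ 18 * y ^ 9 + fps_X ^ m * (?A * ?C * y ^ 9)"
    unfolding minus2 t1 t9 t3 by simp
  \<comment> \<open>The factor \<open>?p ^ 6\<close> cancels \<open>?A * ?C\<close>, and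
    \<open>y ^ 15\<close> completes every term to a monomial in \<open>x = ?p * y\<close> and
    \<open>y\<close>.\<close>
  hence "?p ^ 6 * y ^ 15 * (?p ^ 2 * y) =
      ?p ^ 6 * y ^ 15 * (?p ^ 18 * y ^ 9 + fps_X ^ m * (?A * ?C * y ^ 9))"
    by simp
  also have "\<dots> = (?p ^ 6 * ?p ^ 18) * (y ^ 15 * y ^ 9) + (?A * ?C * ?p ^ 6) * (fps_X ^ m * (y ^ 15 * y ^ 9))"
    by (simp only: distrib_left mult_ac)
  also have "\<dots> = x ^ 24 + fps_X ^ m * y ^ 24"
    unfolding AC by (simp add: x power_mult_distrib flip: power_add)
  also have "?p ^ 6 * y ^ 15 * (?p ^ 2 * y) = (?p ^ 6 * ?p ^ 2) * (y ^ 15 * y)"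
    by (simp only: mult_ac)
  also have "\<dots> = x ^ 8 * y ^ 8"
    by (simp add: x power_mult_distrib mult.assoc flip: power_add power_Suc2)
  finally show ?thesis .
qed

text \<open>
  Eliminating \<open>q\<close> from the two hypotheses leaves a polynomial that factors as \<open>((y - x\<^sup>2) z - y\<^sup>3) ?Q\<close>,
  and \<open>?Q\<close> also divides the eliminated form of the conclusion.
\<close>

lemma psi_relation:
  fixes x y z q :: "'a :: idom"
  assumes 1: "x * y = x ^ 3 + q * y ^ 3" and 2: "y * z = y ^ 3 + q ^ 2 * z ^ 3"
    and nz: "(y - x\<^sup>2) * z - y ^ 3 \<noteq> 0" "y \<noteq> 0"
  shows "y * (x * z) ^ 2 = y ^ 6 - q * (x * z) ^ 3"
proof -
  let ?Q = "(y - x\<^sup>2) * x\<^sup>2 * z\<^sup>2 + x\<^sup>2 * y ^ 3 * z - y ^ 6"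
  have q: "q * y ^ 3 = x * (y - x\<^sup>2)"
    using 1 by (simp add: algebra_simps power2_eq_square power3_eq_cube)
  have "((y - x\<^sup>2) * z - y ^ 3) * ?Q = (x * (y - x\<^sup>2)) ^ 2 * z ^ 3 - y ^ 7 * z + y ^ 9"
    by Groebner_Basis.algebra
  also have "\<dots> = y ^ 6 * (y ^ 3 + q ^ 2 * z ^ 3 - y * z)"
    unfolding q[symmetric] by Groebner_Basis.algebra
  also have "\<dots> = 0"
    using 2 by simp
  finally have "?Q = 0"
    using nz by simp
  \<comment> \<open>The factor \<open>y ^ 3\<close> makes \<open>q\<close> occur only within
    \<open>q * y ^ 3\<close>, which the first hypothesis expresses through \<open>x\<close> and
    \<open>y\<close>.\<close>
  moreover have "y ^ 3 * (y * (x * z) ^ 2 - (y ^ 6 - q * (x * z) ^ 3)) =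
      y ^ 4 * x\<^sup>2 * z\<^sup>2 - y ^ 9 + (q * y ^ 3) * (x * z) ^ 3"
    by Groebner_Basis.algebra
  moreover have "y ^ 4 * x\<^sup>2 * z\<^sup>2 - y ^ 9 + (x * (y - x\<^sup>2)) * (x * z) ^ 3 = (x\<^sup>2 * z + y ^ 3) * ?Q"
    by Groebner_Basis.algebra
  ultimately have "y ^ 3 * (y * (x * z) ^ 2 - (y ^ 6 - q * (x * z) ^ 3)) = 0"
    by (simp only: q mult_zero_right)
  thus ?thesis
    using nz by simp
qed

section \<open>Successive dissections of the generating function of b\<close>

text \<open>\<open>D\<close> has the coefficients b(9n+6), and \<open>sect 1 (sect 0 B)\<close> has
  b(9n+3). In each round, multiplication by a suitable cube turns the series into a polynomial in
  left-hand sides of the known relations; their right-hand sides, expanded modulo 3, have the shape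
  that \<open>sect_eqI\<close> requires.\<close>

lemma sect_b_relations:
  defines "B \<equiv> Abs_fps (\<lambda>n. of_nat (b n)) :: gf3 fps"
  defines "D \<equiv> sect 2 (sect 0 B)"
  shows "sect 1 (sect 2 D) = - D" "sect 0 (sect 2 D) = - sect 1 (sect 0 B)"
proof -
  define x y z q where "x = (qprod 1 1 :: gf3 fps)" and "y = (qprod 2 2 :: gf3 fps)"
    and "z = (qprod 4 4 :: gf3 fps)" and "q = (fps_X :: gf3 fps)"
  define C E D2 where "C = sect 0 B" and "E = sect 1 C" and "D2 = sect 2 D"
  have nz: "x \<noteq> 0" "y \<noteq> 0" "z \<noteq> 0"
    unfolding x_def y_def z_def by (intro qprod_nonzero; simp)+
  have c0: "x $ 0 = 1" "y $ 0 = 1" "z $ 0 = 1"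
    unfolding x_def y_def z_def by (intro qprod_nth_0; simp)+
  have xy: "x ^ 8 * y ^ 8 = x ^ 24 + q * y ^ 24"
    using theta_identity[of 1] by (simp add: x_def y_def q_def)
  have yz: "y ^ 8 * z ^ 8 = y ^ 24 + q ^ 2 * z ^ 24"
    using theta_identity[of 2] by (simp add: y_def z_def q_def)
  have three: "(3 :: gf3 fps) = 0"
    by (rule three_eq_0_gf3_fps)
  have xyz: "y ^ 8 * (x * z) ^ 16 = y ^ 48 - q * (x * z) ^ 24"
  proof -
    \<comment> \<open>\<open>psi_relation\<close> is applied to eighth powers. The factor to be
      cancelled has constant coefficient 1 - 1 - 1 = -1.\<close>
    have "((y ^ 8 - (x ^ 8)\<^sup>2) * z ^ 8 - (y ^ 8) ^ 3) $ 0 = -1"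
      by (simp add: c0 fps_power_zeroth flip: power_mult)
    hence "(y ^ 8 - (x ^ 8)\<^sup>2) * z ^ 8 - (y ^ 8) ^ 3 \<noteq> 0"
      by (metis fps_zero_nth neg_equal_0_iff_equal zero_neq_one)
    thus ?thesis
      using psi_relation[of "x ^ 8" "y ^ 8" q "z ^ 8"] xy yz nz
      by (simp add: power_mult_distrib flip: power_mult)
  qed
  have B: "B * x * z ^ 3 = y ^ 2"
    unfolding B_def x_def y_def z_def by (rule b_generating_function)

  \<comment> \<open>The cube is chosen to turn y^2 / (x z^3) into x^8 y^8, to which
    \<open>xy\<close> applies.\<close>
  have "B * (z * x ^ 3 * y ^ 2) ^ 3 = (B * x * z ^ 3) * (x ^ 8 * y ^ 6)"
    by (simp add: algebra_simps flip: power_mult power_add power_Suc power_Suc2)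
  also have "\<dots> = x ^ 8 * y ^ 8"
    unfolding B by (simp add: algebra_simps flip: power_add)
  also have "\<dots> = (x ^ 8) ^ 3 + fps_X * (y ^ 8) ^ 3 + fps_X ^ 2 * 0 ^ 3"
    unfolding xy q_def by (simp flip: power_mult)
  finally have "z * x ^ 3 * y ^ 2 * C = x ^ 8"
    unfolding C_def by (rule sect_eqI)
  hence "x ^ 3 * (C * y ^ 2 * z) = x ^ 3 * x ^ 5"
    by Groebner_Basis.algebra
  hence C: "C * y ^ 2 * z = x ^ 5"
    using nz by (metis mult_left_cancel power_not_zero)

  \<comment> \<open>The cube turns x^5 / (y^2 z) into the square of the left-hand side of
    \<open>xyz\<close>. Modulo 3, (u - q v)^2 = u^2 + q u v + q^2 v^2, and here u = y^48 and v =
    (xz)^24 are cubes.\<close>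
  have C': "C * (z ^ 11 * x ^ 9 * y ^ 6) ^ 3 =
      (y ^ 32) ^ 3 + fps_X * (y ^ 16 * (x * z) ^ 8) ^ 3 + fps_X ^ 2 * ((x * z) ^ 16) ^ 3"
  proof -
    have "C * (z ^ 11 * x ^ 9 * y ^ 6) ^ 3 = (C * y ^ 2 * z) * (z ^ 32 * x ^ 27 * y ^ 16)"
      by Groebner_Basis.algebra
    also have "\<dots> = (y ^ 8 * (x * z) ^ 16) ^ 2"
      unfolding C by Groebner_Basis.algebra
    also have "\<dots> = (y ^ 32) ^ 3 + q * (y ^ 16 * (x * z) ^ 8) ^ 3 + q ^ 2 * ((x * z) ^ 16) ^ 3
        - 3 * (q * (y ^ 16 * (x * z) ^ 8) ^ 3)"
      unfolding xyz by Groebner_Basis.algebra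
    finally show ?thesis by (simp add: three q_def)
  qed
  have "z ^ 11 * x ^ 9 * y ^ 6 * E = y ^ 16 * (x * z) ^ 8"
    using sect_eqI(2)[OF C'] by (simp add: E_def)
  hence "(z ^ 8 * x ^ 8 * y ^ 6) * (E * x * z ^ 3) = (z ^ 8 * x ^ 8 * y ^ 6) * y ^ 10"
    by Groebner_Basis.algebra
  hence E: "E * x * z ^ 3 = y ^ 10"
    using nz by simp
  have "z ^ 11 * x ^ 9 * y ^ 6 * D = (x * z) ^ 16"
    using sect_eqI(3)[OF C'] by (simp add: D_def C_def)
  hence "(z ^ 11 * x ^ 9) * (D * y ^ 6) = (z ^ 11 * x ^ 9) * (x ^ 7 * z ^ 5)"
    by Groebner_Basis.algebra
  hence D: "D * y ^ 6 = x ^ 7 * z ^ 5"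
    using nz by simp

  \<comment> \<open>Now the left-hand side of \<open>xy\<close> meets the square of that of
    \<open>xyz\<close>. The expansion contains q^3, itself a cube, hence the summand with factor
    \<open>q\<close> inside the first cube.\<close>
  have D': "D * (x ^ 11 * z ^ 9 * y ^ 10) ^ 3 =
      (y ^ 32 * x ^ 8 + q * (y ^ 8 * (x * z) ^ 16)) ^ 3 + fps_X * (y ^ 40 + x ^ 8 * y ^ 16 * (x * z) ^ 8) ^ 3
      + fps_X ^ 2 * (x ^ 8 * (x * z) ^ 16 + y ^ 24 * (x * z) ^ 8) ^ 3"
  proof -
    have "D * (x ^ 11 * z ^ 9 * y ^ 10) ^ 3 = (D * y ^ 6) * (x ^ 33 * z ^ 27 * y ^ 24)"
      by Groebner_Basis.algebra
    also have "\<dots> = (x ^ 8 * y ^ 8) * (y ^ 8 * (x * z) ^ 16) ^ 2"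
      unfolding D by Groebner_Basis.algebra
    also have "\<dots> = (x ^ 24 + q * y ^ 24) * (y ^ 96 + q * (y ^ 48 * (x * z) ^ 24) + q ^ 2 * (x * z) ^ 48)
        - 3 * ((x ^ 24 + q * y ^ 24) * (q * (y ^ 48 * (x * z) ^ 24)))"
      unfolding xy xyz by Groebner_Basis.algebra
    also have "\<dots> = (x ^ 24 + q * y ^ 24) * (y ^ 96 + q * (y ^ 48 * (x * z) ^ 24) + q ^ 2 * (x * z) ^ 48)"
      by (simp add: three)
    finally show ?thesis
      unfolding cube_add_gf3_fps q_def[symmetric] by Groebner_Basis.algebra
  qed
  have "x ^ 11 * z ^ 9 * y ^ 10 * D2 = x ^ 8 * (x * z) ^ 16 + y ^ 24 * (x * z) ^ 8"
    using sect_eqI(3)[OF D'] by (simp add: D2_def)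
  hence "(x ^ 8 * z ^ 8) * (D2 * x ^ 3 * z * y ^ 10) = (x ^ 8 * z ^ 8) * (x ^ 16 * z ^ 8 + y ^ 24)"
    by Groebner_Basis.algebra
  hence D2: "D2 * x ^ 3 * z * y ^ 10 = x ^ 16 * z ^ 8 + y ^ 24"
    using nz by simp

  \<comment> \<open>The two summands become the left-hand side of \<open>xyz\<close> and
    \<open>y ^ 24\<close> times that of \<open>yz\<close>. The first minus sign comes from 2 y^48 =
    -y^48 modulo 3.\<close>
  have D2': "D2 * (x * z ^ 3 * y ^ 6) ^ 3 =
      (- (y ^ 16)) ^ 3 + fps_X * (- ((x * z) ^ 8)) ^ 3 + fps_X ^ 2 * ((y * z) ^ 8) ^ 3"
  proof -
    have "D2 * (x * z ^ 3 * y ^ 6) ^ 3 = (D2 * x ^ 3 * z * y ^ 10) * (z ^ 8 * y ^ 8)"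
      by Groebner_Basis.algebra
    also have "\<dots> = y ^ 8 * (x * z) ^ 16 + y ^ 24 * (y ^ 8 * z ^ 8)"
      unfolding D2 by Groebner_Basis.algebra
    also have "\<dots> = (- (y ^ 16)) ^ 3 + q * (- ((x * z) ^ 8)) ^ 3 + q ^ 2 * ((y * z) ^ 8) ^ 3
        + 3 * y ^ 48"
      unfolding xyz yz by Groebner_Basis.algebra
    finally show ?thesis by (simp add: three q_def)
  qed
  have "x * z ^ 3 * y ^ 6 * sect 1 D2 = - ((x * z) ^ 8)"
    by (rule sect_eqI(2)[OF D2'])
  \<comment> \<open>The same multiplier takes x^7 z^5 / y^6 to (xz)^8, and below it takes y^10 / (x
    z^3) to y^16.\<close>
  hence "(x * z ^ 3 * y ^ 6) * (sect 1 D2 + D) = 0"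
    using D by Groebner_Basis.algebra
  hence "sect 1 D2 = - D"
    using nz by (simp add: eq_neg_iff_add_eq_0)
  thus "sect 1 (sect 2 D) = - D"
    by (simp only: D2_def)
  have "x * z ^ 3 * y ^ 6 * sect 0 D2 = - (y ^ 16)"
    by (rule sect_eqI(1)[OF D2'])
  hence "(x * z ^ 3 * y ^ 6) * (sect 0 D2 + E) = 0"
    using E by Groebner_Basis.algebra
  hence "sect 0 D2 = - E"
    using nz by (simp add: eq_neg_iff_add_eq_0)
  thus "sect 0 (sect 2 D) = - sect 1 (sect 0 B)"
    by (simp only: D2_def E_def C_def)
qed

section \<open>From series identities to the congruences\<close>

lemma cong_3_gf3: "[i = j] (mod 3) \<longleftrightarrow> (of_int i :: gf3) = of_int j"
  using of_int_eq_iff_cong_CHAR[where 'a = gf3, of i j] by (simp only: CHAR_gf3 of_nat_numeral)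

theorem theorem1p2:
  shows "(\<forall>n k::nat. [int (b (3 ^ (2 * (k + 1)) * n + (5 * 3 ^ (2 * (k + 1)) + 3) div 8))
            = (-1) ^ k * int (b (9 * n + 6))] (mod 3))
       \<and> (\<forall>n::nat. [int (b (81 * n + 24)) = - int (b (9 * n + 3))] (mod 3))"
proof (intro conjI allI)
  define \<beta> :: "nat \<Rightarrow> gf3" where "\<beta> n = of_nat (b n)" for n
  have step: "\<beta> (81 * n + 51) = - \<beta> (9 * n + 6)" for n
    using arg_cong[OF sect_b_relations(1), of "\<lambda>f. f $ n"] by (simp add: \<beta>_def algebra_simps)
  have last: "\<beta> (81 * n + 24) = - \<beta> (9 * n + 3)" for n
    using arg_cong[OF sect_b_relations(2), of "\<lambda>f. f $ n"] by (simp add: \<beta>_def algebra_simps)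
  show "[int (b (81 * n + 24)) = - int (b (9 * n + 3))] (mod 3)" for n
    using last[of n] by (simp add: cong_3_gf3 \<beta>_def)
  fix n k
  \<comment> \<open>The argument is kept in the form 9c + 6, starting with c = n. Since 81c + 51 =
    9(9c + 5) + 6, one use of \<open>step\<close> replaces \<open>c\<close> by
    \<open>9 * c + 5\<close> and changes the sign.\<close>
  have "\<exists>c. 3 ^ (2 * (k + 1)) * n + (5 * 3 ^ (2 * (k + 1)) + 3) div 8 = 9 * c + 6 \<and>
      \<beta> (9 * c + 6) = (-1) ^ k * \<beta> (9 * n + 6)"
  proof (induction k)
    case 0
    show ?case by (intro exI[of _ n]) simp
  next
    case (Suc k)
    define t :: nat where "t = 3 ^ (2 * (k + 1))"
    \<comment> \<open>Powers of 9 are 1 modulo 8, so 8 divides 5t + 3 and the division in the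
      statement is exact.\<close>
    have "9 * a mod 8 = a mod 8" for a :: nat
      by presburger
    hence "(3 ^ 2) ^ j mod 8 = (1 :: nat)" for j
      by (induction j) simp_all
    hence t: "t mod 8 = 1"
      unfolding t_def power_mult .
    have t': "3 ^ (2 * (Suc k + 1)) = 9 * t"
      by (simp add: t_def)
    from Suc obtain c where c: "t * n + (5 * t + 3) div 8 = 9 * c + 6"
        "\<beta> (9 * c + 6) = (-1) ^ k * \<beta> (9 * n + 6)"
      unfolding t_def by blast
    from t obtain s where "t = 8 * s + 1"
      by (metis div_mod_decomp mult.commute)
    hence "5 * (9 * t) + 3 = 8 * (45 * s + 6)" "5 * t + 3 = 8 * (5 * s + 1)"
      by simp_all
    hence "(5 * (9 * t) + 3) div 8 = 45 * s + 6" "(5 * t + 3) div 8 = 5 * s + 1"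
      by (metis nonzero_mult_div_cancel_left zero_neq_numeral)+
    \<comment> \<open>Because 9(5t + 3) = (45t + 3) + 24, the new argument is 9 times the old one
      minus 3.\<close>
    hence "(5 * (9 * t) + 3) div 8 + 3 = 9 * ((5 * t + 3) div 8)"
      by linarith
    hence "9 * t * n + (5 * (9 * t) + 3) div 8 = 9 * (9 * c + 5) + 6"
      using c(1) by (simp add: algebra_simps)
    moreover have "\<beta> (9 * (9 * c + 5) + 6) = (-1) ^ Suc k * \<beta> (9 * n + 6)"
      using step[of c] c(2) by (simp add: algebra_simps)
    ultimately show ?case
      unfolding t' by blast
  qed
  thus "[int (b (3 ^ (2 * (k + 1)) * n + (5 * 3 ^ (2 * (k + 1)) + 3) div 8))
      = (-1) ^ k * int (b (9 * n + 6))] (mod 3)"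
    by (auto simp: cong_3_gf3 \<beta>_def)
qed

end
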